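(* Let $\varphi$ be a random product of maps $f_{\theta^{i}(\omega)}$ on a compact metric space $(X,d)$ over an invertible measure-preserving dynamical system $(\Omega,\mathscr{F},\mathbb{P},\theta)$, and suppose that $I_{\mathbb{P}}(\varphi)\neq\emptyset$. If $\varphi$ is strongly synchronizing on average, then $I_{\mathbb{P}}(\varphi)$ is a singleton, and there exists an invariant map $\Phi\colon\Omega\to X$ such that: (i) $\Phi$ is the unique invariant map up to almost everywhere equality, i.e. every invariant map $\Psi\colon\Omega\to X$ satisfies $\Psi(\omega)=\Phi(\omega)$ for $\mathbb{P}$-almost every $\omega$; (ii) $\Phi$ is $\mathscr{F}^{-}$-measurable; (iii) for $\mathbb{P}$-almost every $\omega$, $$\lim_{n\to\infty}\frac1n\sum_{i=0}^{n-1}d\big(f_{\omega}^{i}(x),\Phi(\theta^{i}(\omega))\big)=0\quad\text{for every }x\in X.$$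
   Context: Setting. $(\Omega,\mathscr{F},\mathbb{P},\theta)$ is a measure-preserving dynamical system: $(\Omega,\mathscr{F},\mathbb{P})$ is a probability space and $\theta\colon\Omega\to\Omega$ is measurable and preserves $\mathbb{P}$; invertible means that $\theta$ is a bijection with measurable inverse. $(X,d)$ is a compact metric space with Borel $\sigma$-algebra $\mathscr{B}$, and $f\colon\Omega\times X\to X$ is $\mathscr{F}\otimes\mathscr{B}/\mathscr{B}$-measurable; write $f_\omega(x)=f(\omega,x)$. The random product of maps $f_{\theta^i(\omega)}$ over $(\Omega,\mathscr{F},\mathbb{P},\theta)$ is the map $\varphi(n,\omega,x)=f_\omega^n(x)=f_{\theta^{n-1}(\omega)}\circ\cdots\circ f_\omega(x)$ for $n\ge1$, with $f_\omega^0=\mathrm{id}$. The induced skew product is $F_\varphi\colon\Omega\times X\to\Omega\times X$, $F_\varphi(\omega,x)=(\theta(\omega),f_\omega(x))$. A probability measure $\mu$ on $\Omega\times X$ is $\varphi$-invariant if it is $F_\varphi$-invariant and $(\Pi_1)_*\mu=\mathbb{P}$, where $\Pi_1(\omega,x)=\omega$. $I_{\mathbb{P}}(\varphi)$ is the set of $\varphi$-invariant measures. $\varphi$ is strongly synchronizing on average if for $\mathbb{P}$-almost every $\omega$ one has $\lim_{n\to\infty}\frac1n\sum_{i=0}^{n-1}d(f_\omega^i(x),f_\omega^i(y))=0$ for every $x,y\in X$. An invariant map is a measurable map $\Phi\colon\Omega\to X$ with $f_\omega(\Phi(\omega))=\Phi(\theta(\omega))$ for $\mathbb{P}$-almost every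 $\omega$. The past of $\varphi$ is the sub-$\sigma$-algebra $\mathscr{F}^-=\sigma(\omega\mapsto\varphi(n,\theta^{-n}(\omega),x)\colon n\ge1,\ x\in X)$, i.e. the smallest $\sigma$-algebra on $\Omega$ making all these maps measurable. *)

theory Defs
  imports "HOL-Probability.Probability"
begin

text \<open>
  The base space is a measure \<open>P\<close> with carrier \<open>space P\<close>; maps on the base are total functions
  of which only the values on \<open>space P\<close> matter. The fibre is a metric space type \<open>'x\<close> with its
  Borel sets.
\<close>

definition measure_preserving_system :: "'w measure \<Rightarrow> ('w \<Rightarrow> 'w) \<Rightarrow> bool" where
  "measure_preserving_system P \<theta> \<longleftrightarrow>
     prob_space P \<and> \<theta> \<in> P \<rightarrow>\<^sub>M P \<and> distr P P \<theta> = P"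

definition base_inv :: "'w measure \<Rightarrow> ('w \<Rightarrow> 'w) \<Rightarrow> 'w \<Rightarrow> 'w" where
  "base_inv P \<theta> = the_inv_into (space P) \<theta>"

definition invertible_measure_preserving_system :: "'w measure \<Rightarrow> ('w \<Rightarrow> 'w) \<Rightarrow> bool" where
  "invertible_measure_preserving_system P \<theta> \<longleftrightarrow>
     measure_preserving_system P \<theta> \<and> bij_betw \<theta> (space P) (space P) \<and> base_inv P \<theta> \<in> P \<rightarrow>\<^sub>M P"

primrec random_product ::
  "('w \<Rightarrow> 'w) \<Rightarrow> ('w \<Rightarrow> 'x \<Rightarrow> 'x) \<Rightarrow> nat \<Rightarrow> 'w \<Rightarrow> 'x \<Rightarrow> 'x" where
  "random_product \<theta> f 0 \<omega> = id"
| "random_product \<theta> f (Suc n) \<omega> = f ((\<theta> ^^ n) \<omega>) \<circ> random_product \<theta> f n \<omega>"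

definition skew_product ::
  "('w \<Rightarrow> 'w) \<Rightarrow> ('w \<Rightarrow> 'x \<Rightarrow> 'x) \<Rightarrow> 'w \<times> 'x \<Rightarrow> 'w \<times> 'x" where
  "skew_product \<theta> f = (\<lambda>(\<omega>, x). (\<theta> \<omega>, f \<omega> x))"

definition invariant_measures ::
  "'w measure \<Rightarrow> ('w \<Rightarrow> 'w) \<Rightarrow> ('w \<Rightarrow> 'x::metric_space \<Rightarrow> 'x) \<Rightarrow> ('w \<times> 'x) measure set" where
  "invariant_measures P \<theta> f =
     {\<mu>. sets \<mu> = sets (P \<Otimes>\<^sub>M borel) \<and> prob_space \<mu> \<and>
         distr \<mu> (P \<Otimes>\<^sub>M borel) (skew_product \<theta> f) = \<mu> \<and> distr \<mu> P fst = P}"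

definition strongly_synchronizing_on_average ::
  "'w measure \<Rightarrow> ('w \<Rightarrow> 'w) \<Rightarrow> ('w \<Rightarrow> 'x::metric_space \<Rightarrow> 'x) \<Rightarrow> bool" where
  "strongly_synchronizing_on_average P \<theta> f \<longleftrightarrow>
     (AE \<omega> in P. \<forall>x y.
        (\<lambda>n. (1 / real n) * (\<Sum>i<n. dist (random_product \<theta> f i \<omega> x) (random_product \<theta> f i \<omega> y)))
          \<longlonglongrightarrow> 0)"

definition invariant_map ::
  "'w measure \<Rightarrow> ('w \<Rightarrow> 'w) \<Rightarrow> ('w \<Rightarrow> 'x::metric_space \<Rightarrow> 'x) \<Rightarrow> ('w \<Rightarrow> 'x) \<Rightarrow> bool" where
  "invariant_map P \<theta> f \<Phi> \<longleftrightarrow>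
     \<Phi> \<in> borel_measurable P \<and> (AE \<omega> in P. f \<omega> (\<Phi> \<omega>) = \<Phi> (\<theta> \<omega>))"

text \<open>
  The past is given as a measure so that \<open>measurable\<close> applies to it; only its \<open>\<sigma>\<close>-algebra is
  meaningful. It is not completed with respect to \<open>P\<close>.
\<close>

definition past ::
  "'w measure \<Rightarrow> ('w \<Rightarrow> 'w) \<Rightarrow> ('w \<Rightarrow> 'x::metric_space \<Rightarrow> 'x) \<Rightarrow> 'w measure" where
  "past P \<theta> f = sigma (space P)
     {(\<lambda>\<omega>. random_product \<theta> f n ((base_inv P \<theta> ^^ n) \<omega>) x) -` A \<inter> space P | n x A.
        1 \<le> n \<and> A \<in> sets borel}"

end

theory Submission
  imports Defs
begin

text \<open>
  Fix \<open>x\<^sub>0\<close> and put \<open>g\<^sub>n(\<omega>) = f\<^sup>n\<close> at \<open>\<theta>\<^sup>-\<^sup>n \<omega>\<close> applied to \<open>x\<^sub>0\<close>. For an invariant measure \<open>\<mu>\<close>, the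
  skew product turns the integral of \<open>d(x, g\<^sub>n(\<omega>))\<close> into that of the distance between the
  \<open>n\<close>-th iterates of \<open>x\<close> and \<open>x\<^sub>0\<close> over the same \<open>\<omega>\<close>. By synchronization and dominated convergence
  these integrals tend to 0 on average, hence along a subsequence, and along a further subsequence
  \<open>g\<^sub>n(\<omega>)\<close> tends to \<open>x\<close> for \<open>\<mu>\<close>-almost every \<open>(\<omega>, x)\<close>. So \<open>\<mu>\<close> lives on the graph of
  the past-measurable limit \<open>\<Phi>\<close>; no disintegration of \<open>\<mu>\<close> is needed. If \<open>\<Psi>\<close> is another invariant map,
  then \<open>d(\<Phi>, \<Psi>)\<close> has vanishing ergodic averages, so its integral is 0.
\<close>

section \<open>Measurability of distances and limits in a compact metric space\<close>

lemma countable_dense_of_compact_UNIV: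
  assumes "compact (UNIV :: 'x::metric_space set)"
  obtains D :: "'x::metric_space set" where "countable D" "\<And>x e. e > 0 \<Longrightarrow> \<exists>q\<in>D. dist x q < e"
proof -
  have "\<forall>n. \<exists>K. finite K \<and> (UNIV::'x set) \<subseteq> (\<Union>x\<in>K. ball x (1 / real (Suc n)))"
    using compact_imp_seq_compact[OF assms] seq_compact_imp_totally_bounded by fastforce
  then obtain K where K: "\<And>n. finite (K n)" "\<And>n. (UNIV::'x set) \<subseteq> (\<Union>x\<in>K n. ball x (1 / real (Suc n)))"
    by metis
  show ?thesis
  proof
    show "countable (\<Union>n. K n)" using K(1) by (simp add: countable_finite)
    fix x :: 'x and e :: real assume "e > 0"
    then obtain n where n: "1 / real (Suc n) < e" using nat_approx_posE by blast
    obtain q where "q \<in> K n" "dist q x < 1 / real (Suc n)" using K(2)[of n] UNIV_I[of x] by (meson UN_iff mem_ball subsetD)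
    with n show "\<exists>q\<in>\<Union>n. K n. dist x q < e" by (metis UN_I UNIV_I dist_commute order_less_trans)
  qed
qed

text \<open>Separability comes from compactness here, not from a type class. A countable dense set
  of points \<open>q\<close> bounds \<open>dist x y\<close> through
  \<open>dist x q + dist y q\<close>, so a sublevel set of the distance is a countable union of sets
  that involve only distances to a fixed point, each continuous in one variable.\<close>

lemma borel_measurable_dist_compact:
  fixes u v :: "'a \<Rightarrow> 'x::metric_space"
  assumes "compact (UNIV :: 'x set)" and [measurable]: "u \<in> borel_measurable M" "v \<in> borel_measurable M"
  shows "(\<lambda>\<omega>. dist (u \<omega>) (v \<omega>)) \<in> borel_measurable M"
proof (rule borel_measurableI_less)
  fix a :: real
  obtain D :: "'x set" where D: "countable D" "\<And>x e. e > 0 \<Longrightarrow> \<exists>q\<in>D. dist x q < e"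
    using countable_dense_of_compact_UNIV[OF assms(1)] by blast
  have [measurable]: "(\<lambda>\<omega>. dist (w \<omega>) q) \<in> borel_measurable M"
    if "w \<in> borel_measurable M" for w :: "'a \<Rightarrow> 'x" and q
    by (rule borel_measurable_continuous_on[OF _ that, of "\<lambda>x. dist x q"]) (intro continuous_intros)
  have "dist x y < a \<longleftrightarrow> (\<exists>q\<in>D. dist x q + dist y q < a)" for x y :: 'x
  proof
    assume "dist x y < a"
    then obtain q where "q \<in> D" "dist x q < (a - dist x y) / 2" using D(2)[of "(a - dist x y) / 2" x] by auto
    moreover have "dist y q \<le> dist x y + dist x q" by (metis dist_commute dist_triangle)
    ultimately show "\<exists>q\<in>D. dist x q + dist y q < a" by (intro bexI[of _ q]) (auto simp: field_simps)
  next
    assume "\<exists>q\<in>D. dist x q + dist y q < a"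
    then show "dist x y < a" by (meson dist_triangle2 le_less_trans)
  qed
  then have "{\<omega>\<in>space M. dist (u \<omega>) (v \<omega>) < a} = (\<Union>q\<in>D. {\<omega>\<in>space M. dist (u \<omega>) q + dist (v \<omega>) q < a})"
    by auto
  also have "\<dots> \<in> sets M" using D(1) by (intro sets.countable_UN'') measurable
  finally show "{\<omega>\<in>space M. dist (u \<omega>) (v \<omega>) < a} \<in> sets M" .
qed

text \<open>Compactness gives completeness, so convergence is the Cauchy condition, a countable
  combination of measurable distance conditions. Freezing the sequence at \<open>c\<close> where it
  diverges makes it converge everywhere; no null set is discarded, so the lemma applies to the
  uncompleted past.\<close>

lemma borel_measurable_lim_compact:
  fixes g :: "nat \<Rightarrow> 'a \<Rightarrow> 'x::metric_space"
  assumes "compact (UNIV :: 'x set)" and [measurable]: "\<And>n. g n \<in> borel_measurable M"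
  shows "(\<lambda>\<omega>. if convergent (\<lambda>n. g n \<omega>) then lim (\<lambda>n. g n \<omega>) else c) \<in> borel_measurable M"
proof -
  have [measurable]: "(\<lambda>\<omega>. dist (g m \<omega>) (g n \<omega>)) \<in> borel_measurable M" for m n
    using assms by (intro borel_measurable_dist_compact)
  have conv: "convergent X \<longleftrightarrow> Cauchy X" for X :: "nat \<Rightarrow> 'x"
    using compact_imp_complete[OF assms(1)] convergent_Cauchy
    by (auto simp: complete_def convergent_def)
  have "(convergent (\<lambda>n. g n \<omega>)) \<longleftrightarrow> (\<forall>j. \<exists>N. \<forall>m\<ge>N. \<forall>n\<ge>N. dist (g m \<omega>) (g n \<omega>) < inverse (real (Suc j)))" for \<omega>
    unfolding conv metric_Cauchy_iff2 ..
  then have [measurable]: "Measurable.pred M (\<lambda>\<omega>. convergent (\<lambda>n. g n \<omega>))" by simp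
  show ?thesis
  proof (rule borel_measurable_LIMSEQ_metric)
    show "(\<lambda>\<omega>. if convergent (\<lambda>n. g n \<omega>) then g i \<omega> else c) \<in> borel_measurable M" for i
      by measurable
    show "(\<lambda>i. if convergent (\<lambda>n. g n \<omega>) then g i \<omega> else c)
      \<longlonglongrightarrow> (if convergent (\<lambda>n. g n \<omega>) then lim (\<lambda>n. g n \<omega>) else c)" for \<omega>
      by (simp add: convergent_LIMSEQ_iff)
  qed
qed

section \<open>Cesaro averages and measure-preserving maps\<close>

lemma subseq_tendsto_zero_of_cesaro:
  fixes a :: "nat \<Rightarrow> real"
  assumes "\<And>n. a n \<ge> 0" and "(\<lambda>n. (1 / real n) * (\<Sum>i<n. a i)) \<longlonglongrightarrow> 0"
  shows "\<exists>r. strict_mono r \<and> (\<lambda>k. a (r k)) \<longlonglongrightarrow> 0"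
proof -
  have small: "\<exists>n>N. a n < e" if "e > 0" for N e
  proof (rule ccontr)
    assume "\<not> (\<exists>n>N. a n < e)"
    then have ge: "a n \<ge> e" if "n > N" for n using that by force
    have "eventually (\<lambda>n. (1 / real n) * (\<Sum>i<n. a i) < e / 2) sequentially"
      using order_tendstoD(2)[OF assms(2), of "e / 2"] \<open>e > 0\<close> by simp
    then obtain n0 where n0: "\<And>n. n \<ge> n0 \<Longrightarrow> (1 / real n) * (\<Sum>i<n. a i) < e / 2"
      unfolding eventually_sequentially by blast
    \<comment> \<open>If all terms beyond \<open>N\<close> were at least \<open>e\<close>, then for
      \<open>n \<ge> 2 * (N + 1)\<close> at least half of the first \<open>n\<close> terms would be,
      and the average would be at least \<open>e / 2\<close>.\<close>
    define n where "n = n0 + 2 * (N + 1)"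
    have "real (n - (N + 1)) * e = (\<Sum>i\<in>{N+1..<n}. e)" by simp
    also have "\<dots> \<le> (\<Sum>i\<in>{N+1..<n}. a i)" by (intro sum_mono ge) auto
    also have "\<dots> \<le> (\<Sum>i<n. a i)" by (intro sum_mono2 assms(1)) auto
    finally have 1: "real (n - (N + 1)) * e \<le> (\<Sum>i<n. a i)" .
    have "(\<Sum>i<n. a i) < real n * (e / 2)"
      using n0[of n] by (simp add: n_def field_simps)
    with 1 have "real (n - (N + 1)) * e < (real n / 2) * e" by simp
    then have "real (n - (N + 1)) < real n / 2" using \<open>e > 0\<close> by (simp only: mult_less_cancel_right_pos)
    then show False by (simp add: n_def of_nat_diff)
  qed
  obtain s where s: "\<And>N e. e > 0 \<Longrightarrow> s N e > N \<and> a (s N e) < e"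
    using that[of "\<lambda>N e. SOME n. n > N \<and> a n < e"] someI_ex[OF small] by blast
  \<comment> \<open>Each index is chosen beyond the previous one with the next tolerance, so that
    \<open>a (r k) < 1 / (k + 1)\<close>.\<close>
  define r where "r = rec_nat (s 0 (inverse (real (Suc 0)))) (\<lambda>k n. s n (inverse (real (Suc (Suc k)))))"
  have r_Suc: "r (Suc k) = s (r k) (inverse (real (Suc (Suc k))))" for k by (simp add: r_def)
  have "strict_mono r" unfolding strict_mono_Suc_iff r_Suc using s by simp
  moreover have "a (r k) < inverse (real (Suc k))" for k
    using s by (cases k) (simp_all add: r_Suc r_def del: of_nat_Suc)
  then have "(\<lambda>k. a (r k)) \<longlonglongrightarrow> 0"
    by (intro real_tendsto_sandwich[OF _ _ tendsto_const LIMSEQ_inverse_real_of_nat])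
      (auto simp: assms(1) less_imp_le)
  ultimately show ?thesis by blast
qed

lemma distr_funpow_invariant:
  assumes "T \<in> M \<rightarrow>\<^sub>M M" and "distr M M T = M"
  shows "distr M M (T ^^ n) = M"
proof (induction n)
  case (Suc n)
  have "distr M M (T ^^ Suc n) = distr (distr M M (T ^^ n)) M T"
    using assms(1) by (simp add: distr_distr measurable_compose_n comp_def)
  with Suc assms(2) show ?case by (simp del: funpow.simps)
qed (simp add: id_def distr_id)

text \<open>The exceptional points form a countable union of preimages of one null set under
  measure-preserving maps.\<close>

lemma AE_funpow_invariant:
  assumes "T \<in> M \<rightarrow>\<^sub>M M" and "distr M M T = M" and "AE x in M. Q x"
  shows "AE x in M. \<forall>n. Q ((T ^^ n) x)"
proof -
  have "AE x in M. Q ((T ^^ n) x)" for n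
  proof (rule AE_distrD[where P = Q and M' = M])
    show "T ^^ n \<in> M \<rightarrow>\<^sub>M M" using assms(1) by (rule measurable_compose_n)
    show "AE x in distr M M (T ^^ n). Q x" unfolding distr_funpow_invariant[OF assms(1,2)] by (rule assms(3))
  qed
  then show ?thesis by (simp add: AE_all_countable)
qed

text \<open>Invariance gives \<open>h i\<close> and its composition with \<open>T ^^ i\<close> the
  same integral, so dominated convergence along orbits controls the averages of the integrals.
  Letting \<open>h\<close> depend on \<open>i\<close> is what admits the pullback distances.\<close>

lemma (in prob_space) integral_cesaro_tendsto_zero:
  fixes h :: "nat \<Rightarrow> 'a \<Rightarrow> real"
  assumes T: "T \<in> M \<rightarrow>\<^sub>M M" "distr M M T = M"
    and [measurable]: "\<And>i. h i \<in> borel_measurable M"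
    and bound: "\<And>i x. \<bar>h i x\<bar> \<le> B"
    and conv: "AE x in M. (\<lambda>n. (1 / real n) * (\<Sum>i<n. h i ((T ^^ i) x))) \<longlonglongrightarrow> 0"
  shows "(\<lambda>n. (1 / real n) * (\<Sum>i<n. \<integral>x. h i x \<partial>M)) \<longlonglongrightarrow> 0"
proof -
  have [measurable]: "T ^^ i \<in> M \<rightarrow>\<^sub>M M" for i using T(1) by (rule measurable_compose_n)
  have "B \<ge> 0" using bound[of 0 undefined] by linarith
  have int: "integrable M (\<lambda>x. h i ((T ^^ i) x))" for i
    by (rule integrable_const_bound[of _ B]) (auto simp: bound)
  have eq: "(\<integral>x. h i ((T ^^ i) x) \<partial>M) = (\<integral>x. h i x \<partial>M)" for i
    using integral_distr[of "T ^^ i" M M "h i"] by (simp add: distr_funpow_invariant[OF T])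
  have "(\<lambda>n. \<integral>x. (1 / real n) * (\<Sum>i<n. h i ((T ^^ i) x)) \<partial>M) \<longlonglongrightarrow> (\<integral>x. 0 \<partial>M)"
  proof (rule integral_dominated_convergence)
    show "AE x in M. norm ((1 / real n) * (\<Sum>i<n. h i ((T ^^ i) x))) \<le> B" for n
    proof (intro AE_I2)
      fix x
      have "\<bar>\<Sum>i<n. h i ((T ^^ i) x)\<bar> \<le> (\<Sum>i<n. B)"
        by (rule order_trans[OF sum_abs]) (intro sum_mono bound)
      then show "norm ((1 / real n) * (\<Sum>i<n. h i ((T ^^ i) x))) \<le> B"
        using \<open>B \<ge> 0\<close> by (cases "n = 0") (simp_all add: abs_mult field_simps)
    qed
  qed (use conv in auto)
  then show ?thesis using int by (simp add: integral_sum eq)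
qed

section \<open>Random products, skew products and the past\<close>

lemma random_product_measurable:
  fixes f :: "'w \<Rightarrow> 'x::metric_space \<Rightarrow> 'x"
  assumes [measurable]: "\<theta> \<in> P \<rightarrow>\<^sub>M P"
    and f: "(\<lambda>(\<omega>, x). f \<omega> x) \<in> P \<Otimes>\<^sub>M (borel :: 'x measure) \<rightarrow>\<^sub>M (borel :: 'x measure)"
  shows "(\<lambda>p. random_product \<theta> f n (fst p) (snd p)) \<in> P \<Otimes>\<^sub>M borel \<rightarrow>\<^sub>M borel"
proof (induction n)
  case (Suc n)
  note [measurable] = Suc measurable_compose_n[OF assms(1)]
  have "(\<lambda>p. ((\<theta> ^^ n) (fst p), random_product \<theta> f n (fst p) (snd p))) \<in> P \<Otimes>\<^sub>M borel \<rightarrow>\<^sub>M P \<Otimes>\<^sub>M borel"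
    by measurable
  from measurable_compose[OF this f] show ?case by simp
qed simp

lemma skew_product_funpow:
  "(skew_product \<theta> f ^^ n) (\<omega>, x) = ((\<theta> ^^ n) \<omega>, random_product \<theta> f n \<omega> x)"
  by (induction n) (simp_all add: skew_product_def)

lemma skew_product_measurable:
  fixes f :: "'w \<Rightarrow> 'x::metric_space \<Rightarrow> 'x"
  assumes "\<theta> \<in> P \<rightarrow>\<^sub>M P"
    and "(\<lambda>(\<omega>, x). f \<omega> x) \<in> P \<Otimes>\<^sub>M (borel :: 'x measure) \<rightarrow>\<^sub>M (borel :: 'x measure)"
  shows "skew_product \<theta> f \<in> P \<Otimes>\<^sub>M borel \<rightarrow>\<^sub>M P \<Otimes>\<^sub>M borel"
  using assms unfolding skew_product_def split_beta' by measurable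

text \<open>Every such orbit ends in the fibre over \<open>\<omega>\<close> itself, so different
  \<open>n\<close> can be compared there. For \<open>n \<ge> 1\<close> these maps generate
  \<open>past\<close>.\<close>

definition pullback_orbit ::
  "'w measure \<Rightarrow> ('w \<Rightarrow> 'w) \<Rightarrow> ('w \<Rightarrow> 'x \<Rightarrow> 'x) \<Rightarrow> 'x \<Rightarrow> nat \<Rightarrow> 'w \<Rightarrow> 'x" where
  "pullback_orbit P \<theta> f x n \<omega> = random_product \<theta> f n ((base_inv P \<theta> ^^ n) \<omega>) x"

lemma space_past [simp]: "space (past P \<theta> f) = space P"
  unfolding past_def by (rule space_measure_of) auto

lemma pullback_orbit_measurable_past:
  assumes "n \<ge> 1"
  shows "pullback_orbit P \<theta> f x n \<in> borel_measurable (past P \<theta> f)"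
proof (rule measurableI)
  fix A :: "'b set" assume "A \<in> sets borel"
  then show "pullback_orbit P \<theta> f x n -` A \<inter> space (past P \<theta> f) \<in> sets (past P \<theta> f)"
    unfolding space_past using assms unfolding past_def pullback_orbit_def
    by (subst sets_measure_of) (auto intro!: sigma_sets.Basic)
qed simp

section \<open>Synchronizing random products: pullback orbits and invariant maps\<close>

locale random_map_product =
  fixes P :: "'w measure"
    and \<theta> :: "'w \<Rightarrow> 'w"
    and f :: "'w \<Rightarrow> 'x::metric_space \<Rightarrow> 'x"
  assumes cpt: "compact (UNIV :: 'x set)"
    and base: "invertible_measure_preserving_system P \<theta>"
    and f_meas: "(\<lambda>(\<omega>, x). f \<omega> x) \<in> P \<Otimes>\<^sub>M (borel :: 'x measure) \<rightarrow>\<^sub>M (borel :: 'x measure)"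
    and sync: "strongly_synchronizing_on_average P \<theta> f"
begin

lemma prob_P: "prob_space P"
  and theta_meas [measurable]: "\<theta> \<in> P \<rightarrow>\<^sub>M P"
  and theta_inv: "distr P P \<theta> = P"
  and theta_bij: "bij_betw \<theta> (space P) (space P)"
  and base_inv_meas: "base_inv P \<theta> \<in> P \<rightarrow>\<^sub>M P"
  using base by (auto simp: invertible_measure_preserving_system_def measure_preserving_system_def)

lemma dist_meas:
  fixes u v :: "'a \<Rightarrow> 'x"
  shows "u \<in> borel_measurable M \<Longrightarrow> v \<in> borel_measurable M \<Longrightarrow> (\<lambda>\<omega>. dist (u \<omega>) (v \<omega>)) \<in> borel_measurable M"
  using cpt by (rule borel_measurable_dist_compact)

lemma dist_bounded: obtains B where "\<And>x y :: 'x. dist x y \<le> B"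
  using compact_imp_bounded[OF cpt] unfolding bounded_two_points by auto

lemma base_inv_funpow: "\<omega> \<in> space P \<Longrightarrow> (base_inv P \<theta> ^^ n) ((\<theta> ^^ n) \<omega>) = \<omega>"
proof (induction n arbitrary: \<omega>)
  case (Suc n)
  have "(\<theta> ^^ n) \<omega> \<in> space P"
    using measurable_space[OF measurable_compose_n[OF theta_meas] Suc.prems] .
  then have "base_inv P \<theta> ((\<theta> ^^ Suc n) \<omega>) = (\<theta> ^^ n) \<omega>"
    using theta_bij by (simp add: base_inv_def bij_betw_def the_inv_into_f_f)
  then show ?case using Suc by (simp only: funpow_Suc_right comp_apply)
qed simp

text \<open>This exchanges pullback for forward orbits: synchronization concerns the latter,
  past-measurability the former.\<close>

lemma pullback_orbit_funpow:
  "\<omega> \<in> space P \<Longrightarrow> pullback_orbit P \<theta> f x n ((\<theta> ^^ n) \<omega>) = random_product \<theta> f n \<omega> x"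
  by (simp add: pullback_orbit_def base_inv_funpow)

lemma pullback_orbit_measurable: "pullback_orbit P \<theta> f x n \<in> borel_measurable P"
proof -
  have "(\<lambda>\<omega>. ((base_inv P \<theta> ^^ n) \<omega>, x)) \<in> P \<rightarrow>\<^sub>M P \<Otimes>\<^sub>M borel"
    using measurable_compose_n[OF base_inv_meas] by measurable
  from measurable_compose[OF this random_product_measurable[OF theta_meas f_meas, of n]]
  show ?thesis by (simp add: pullback_orbit_def[abs_def])
qed

lemma invariant_map_orbit:
  assumes "invariant_map P \<theta> f \<Psi>"
  shows "AE \<omega> in P. \<forall>i. \<Psi> ((\<theta> ^^ i) \<omega>) = random_product \<theta> f i \<omega> (\<Psi> \<omega>)"
proof -
  have "AE \<omega> in P. f \<omega> (\<Psi> \<omega>) = \<Psi> (\<theta> \<omega>)" using assms by (simp add: invariant_map_def)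
  from AE_funpow_invariant[OF theta_meas theta_inv this]
  show ?thesis
  proof eventually_elim
    case (elim \<omega>)
    show ?case
    proof
      show "\<Psi> ((\<theta> ^^ i) \<omega>) = random_product \<theta> f i \<omega> (\<Psi> \<omega>)" for i
        using elim by (induction i) (simp_all, metis)
    qed
  qed
qed

text \<open>The values of \<open>\<Psi>\<close> along the base orbit are themselves a fibre orbit,
  started at \<open>\<Psi> \<omega>\<close>. The null set in the synchronization hypothesis is the
  same for all pairs of points, so the second point may depend on \<open>\<omega>\<close>.\<close>

lemma invariant_map_attracts:
  assumes "invariant_map P \<theta> f \<Psi>"
  shows "AE \<omega> in P. \<forall>x. (\<lambda>n. (1 / real n) *
    (\<Sum>i<n. dist (random_product \<theta> f i \<omega> x) (\<Psi> ((\<theta> ^^ i) \<omega>)))) \<longlonglongrightarrow> 0"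
  using invariant_map_orbit[OF assms] sync[unfolded strongly_synchronizing_on_average_def]
  by eventually_elim simp

lemma invariant_map_unique:
  assumes \<Phi>: "invariant_map P \<theta> f \<Phi>" and \<Psi>: "invariant_map P \<theta> f \<Psi>"
  shows "AE \<omega> in P. \<Psi> \<omega> = \<Phi> \<omega>"
proof -
  interpret prob_space P by (rule prob_P)
  obtain B where B: "\<And>x y :: 'x. dist x y \<le> B" using dist_bounded by blast
  let ?h = "\<lambda>\<omega>. dist (\<Psi> \<omega>) (\<Phi> \<omega>)"
  have [measurable]: "?h \<in> borel_measurable P"
    using \<Phi> \<Psi> by (intro dist_meas) (simp_all add: invariant_map_def)
  have "(\<lambda>n. (1 / real n) * (\<Sum>i<n. \<integral>\<omega>. ?h \<omega> \<partial>P)) \<longlonglongrightarrow> 0"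
  proof (rule integral_cesaro_tendsto_zero[OF theta_meas theta_inv])
    show "AE \<omega> in P. (\<lambda>n. (1 / real n) * (\<Sum>i<n. ?h ((\<theta> ^^ i) \<omega>))) \<longlonglongrightarrow> 0"
      using invariant_map_attracts[OF \<Phi>] invariant_map_orbit[OF \<Psi>] by eventually_elim simp
  qed (use B in auto)
  \<comment> \<open>At \<open>n = 0\<close> the average is 0 by the convention for division, so
    equality is claimed only eventually.\<close>
  moreover have "eventually (\<lambda>n. (1 / real n) * (\<Sum>i<n. \<integral>\<omega>. ?h \<omega> \<partial>P) = (\<integral>\<omega>. ?h \<omega> \<partial>P)) sequentially"
    using eventually_gt_at_top[of 0] by eventually_elim simp
  ultimately have "(\<lambda>_. \<integral>\<omega>. ?h \<omega> \<partial>P) \<longlonglongrightarrow> 0"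
    using tendsto_cong by fast
  then have "(\<integral>\<omega>. ?h \<omega> \<partial>P) = 0" by (simp add: LIMSEQ_const_iff)
  moreover have "integrable P ?h"
    by (rule integrable_const_bound[of _ B]) (auto simp: B)
  ultimately show ?thesis by (subst (asm) integral_nonneg_eq_0_iff_AE) auto
qed

section \<open>Invariant measures as graph measures\<close>

lemma invariant_measure_is_graph:
  assumes \<mu>: "\<mu> \<in> invariant_measures P \<theta> f"
  obtains \<Phi> where "invariant_map P \<theta> f \<Phi>" "\<Phi> \<in> borel_measurable (past P \<theta> f)"
    "\<mu> = distr P (P \<Otimes>\<^sub>M borel) (\<lambda>\<omega>. (\<omega>, \<Phi> \<omega>))"
proof -
  let ?F = "skew_product \<theta> f"
  have sets_\<mu> [measurable_cong]: "sets \<mu> = sets (P \<Otimes>\<^sub>M borel)"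
    and prob_\<mu>: "prob_space \<mu>"
    and F_inv': "distr \<mu> (P \<Otimes>\<^sub>M borel) ?F = \<mu>"
    and fst_\<mu>: "distr \<mu> P fst = P"
    using \<mu> by (auto simp: invariant_measures_def)
  interpret prob_space \<mu> by (rule prob_\<mu>)
  have F_meas: "?F \<in> \<mu> \<rightarrow>\<^sub>M \<mu>"
    using skew_product_measurable[OF theta_meas f_meas] by (simp cong: measurable_cong_sets add: sets_\<mu>)
  have F_inv: "distr \<mu> \<mu> ?F = \<mu>"
    using F_inv' by (metis distr_cong sets_\<mu>)
  have space_\<mu>: "space \<mu> = space P \<times> UNIV"
    using sets_eq_imp_space_eq[OF sets_\<mu>] by (simp add: space_pair_measure)
  have AE_fst: "AE p in \<mu>. Q (fst p)" if "AE \<omega> in P. Q \<omega>" for Q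
    by (rule AE_distrD[where P = Q and M' = P]) (simp, unfold fst_\<mu>, rule that)
  obtain B where B: "\<And>x y :: 'x. dist x y \<le> B" using dist_bounded by blast

  \<comment> \<open>Any reference point would do.\<close>
  define x0 :: 'x where "x0 = undefined"
  define g where "g = pullback_orbit P \<theta> f x0"
  define h where "h n p = dist (snd p) (g n (fst p))" for n p
  have g_meas [measurable]: "g n \<in> borel_measurable P" for n
    unfolding g_def by (rule pullback_orbit_measurable)
  have h_meas [measurable]: "h n \<in> borel_measurable \<mu>" for n
    unfolding h_def by (rule dist_meas) measurable
  have h_int: "integrable \<mu> (h n)" for n
    by (rule integrable_const_bound[of _ B]) (auto simp: h_def B)

  have "(\<lambda>n. (1 / real n) * (\<Sum>i<n. \<integral>p. h i p \<partial>\<mu>)) \<longlonglongrightarrow> 0"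
  proof (rule integral_cesaro_tendsto_zero[OF F_meas F_inv h_meas])
    show "\<bar>h i p\<bar> \<le> B" for i p by (simp add: h_def B)
    \<comment> \<open>The first marginal of \<open>\<mu>\<close> is \<open>P\<close>, so
      synchronization holds over \<open>\<mu>\<close>-almost every \<open>p\<close>; it is applied
      to the points \<open>snd p\<close> and \<open>x0\<close>.\<close>
    show "AE p in \<mu>. (\<lambda>n. (1 / real n) * (\<Sum>i<n. h i ((?F ^^ i) p))) \<longlonglongrightarrow> 0"
      using AE_fst[OF sync[unfolded strongly_synchronizing_on_average_def]] AE_space
    proof eventually_elim
      case (elim p)
      then have "h i ((?F ^^ i) p) =
          dist (random_product \<theta> f i (fst p) (snd p)) (random_product \<theta> f i (fst p) x0)" for i
        using skew_product_funpow[where n = i and x = "snd p" and \<omega> = "fst p" and \<theta> = \<theta> and f = f]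
        by (auto simp: h_def g_def space_\<mu> pullback_orbit_funpow)
      then show ?case using elim(1) by simp
    qed
  qed
  then obtain r where r: "strict_mono r" "(\<lambda>k. \<integral>p. h (r k) p \<partial>\<mu>) \<longlonglongrightarrow> 0"
    using subseq_tendsto_zero_of_cesaro[of "\<lambda>n. \<integral>p. h n p \<partial>\<mu>"]
    by (auto simp: h_def)
  obtain s where s: "strict_mono s" "AE p in \<mu>. (\<lambda>k. h (r (s k)) p) \<longlonglongrightarrow> 0"
    using tendsto_L1_AE_subseq[of \<mu> "\<lambda>k. h (r k)"] h_int r(2)
    by (auto simp: h_def)
  \<comment> \<open>The shift by \<open>Suc\<close> forces \<open>q k \<ge> 1\<close>, so every
    \<open>g (q k)\<close> is one of the generators of the past.\<close>
  define q where "q k = r (s (Suc k))" for k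
  have q_ge: "q k \<ge> 1" for k
    using strict_mono_imp_increasing[OF strict_mono_o[OF r(1) s(1)], of "Suc k"]
    by (simp add: q_def)
  define \<Phi> where "\<Phi> \<omega> = (if convergent (\<lambda>k. g (q k) \<omega>) then lim (\<lambda>k. g (q k) \<omega>) else x0)" for \<omega>
  have \<Phi>_past: "\<Phi> \<in> borel_measurable (past P \<theta> f)"
    unfolding \<Phi>_def g_def using q_ge
    by (intro borel_measurable_lim_compact[OF cpt] pullback_orbit_measurable_past)
  have \<Phi>_meas [measurable]: "\<Phi> \<in> borel_measurable P"
    unfolding \<Phi>_def by (intro borel_measurable_lim_compact[OF cpt]) measurable

  have graph: "AE p in \<mu>. snd p = \<Phi> (fst p)"
    using s(2)
  proof eventually_elim
    case (elim p)
    then have "(\<lambda>k. h (q k) p) \<longlonglongrightarrow> 0" unfolding q_def by (rule LIMSEQ_Suc)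
    then have "(\<lambda>k. g (q k) (fst p)) \<longlonglongrightarrow> snd p"
      by (subst tendsto_dist_iff) (simp add: h_def dist_commute)
    then show ?case by (auto simp: \<Phi>_def limI convergent_def)
  qed
  \<comment> \<open>The identity agrees almost everywhere with a map that factors through
    \<open>fst\<close>, whose law is \<open>P\<close>.\<close>
  have "\<mu> = distr \<mu> (P \<Otimes>\<^sub>M borel) (\<lambda>p. p)"
    by (rule distr_id2[OF sets_\<mu>[symmetric], symmetric])
  also have "\<dots> = distr \<mu> (P \<Otimes>\<^sub>M borel) (\<lambda>p. (fst p, \<Phi> (fst p)))"
    using graph by (intro distr_cong_AE) (auto simp: prod_eq_iff)
  also have "\<dots> = distr (distr \<mu> P fst) (P \<Otimes>\<^sub>M borel) (\<lambda>\<omega>. (\<omega>, \<Phi> \<omega>))"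
    by (subst distr_distr) (auto simp: comp_def)
  finally have \<mu>_graph: "\<mu> = distr P (P \<Otimes>\<^sub>M borel) (\<lambda>\<omega>. (\<omega>, \<Phi> \<omega>))" by (simp only: fst_\<mu>)

  \<comment> \<open>By invariance of \<open>\<mu>\<close>, the image \<open>?F p\<close> also lies
    on the graph almost surely. Reading this at \<open>p = (\<omega>, \<Phi> \<omega>)\<close> gives
    the invariance equation for \<open>\<Phi>\<close>.\<close>
  have "AE p in \<mu>. snd (?F p) = \<Phi> (fst (?F p))"
    by (rule AE_distrD[OF F_meas, where P = "\<lambda>p. snd p = \<Phi> (fst p)"]) (unfold F_inv, rule graph)
  then have "AE p in \<mu>. f (fst p) (snd p) = \<Phi> (\<theta> (fst p))"
    by (simp add: skew_product_def split_beta)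
  then have "AE \<omega> in P. f \<omega> (\<Phi> \<omega>) = \<Phi> (\<theta> \<omega>)"
    by (subst (asm) \<mu>_graph) (auto dest!: AE_distrD[rotated])
  then have "invariant_map P \<theta> f \<Phi>" by (simp add: invariant_map_def)
  then show ?thesis using \<Phi>_past \<mu>_graph by (rule that)
qed

text \<open>Both measures are carried by graphs of invariant maps; these maps agree almost
  everywhere, hence so do their graph embeddings of \<open>P\<close>.\<close>

lemma invariant_measure_unique:
  assumes "\<mu> \<in> invariant_measures P \<theta> f" "\<nu> \<in> invariant_measures P \<theta> f"
  shows "\<nu> = \<mu>"
proof -
  obtain \<Phi> where \<Phi>: "invariant_map P \<theta> f \<Phi>" "\<mu> = distr P (P \<Otimes>\<^sub>M borel) (\<lambda>\<omega>. (\<omega>, \<Phi> \<omega>))"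
    using invariant_measure_is_graph[OF assms(1)] .
  obtain \<Psi> where \<Psi>: "invariant_map P \<theta> f \<Psi>" "\<nu> = distr P (P \<Otimes>\<^sub>M borel) (\<lambda>\<omega>. (\<omega>, \<Psi> \<omega>))"
    using invariant_measure_is_graph[OF assms(2)] .
  have [measurable]: "\<Phi> \<in> borel_measurable P" "\<Psi> \<in> borel_measurable P"
    using \<Phi>(1) \<Psi>(1) by (simp_all add: invariant_map_def)
  show ?thesis unfolding \<Phi>(2) \<Psi>(2)
    using invariant_map_unique[OF \<Phi>(1) \<Psi>(1)] by (intro distr_cong_AE) auto
qed

end

theorem theorem1:
  fixes P :: "'w measure"
    and \<theta> :: "'w \<Rightarrow> 'w"
    and f :: "'w \<Rightarrow> 'x::metric_space \<Rightarrow> 'x"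
  assumes "compact (UNIV :: 'x set)"
    and "invertible_measure_preserving_system P \<theta>"
    and "(\<lambda>(\<omega>, x). f \<omega> x) \<in> P \<Otimes>\<^sub>M (borel :: 'x measure) \<rightarrow>\<^sub>M (borel :: 'x measure)"
    and "invariant_measures P \<theta> f \<noteq> {}"
    and "strongly_synchronizing_on_average P \<theta> f"
  shows "is_singleton (invariant_measures P \<theta> f) \<and>
    (\<exists>\<Phi> :: 'w \<Rightarrow> 'x. invariant_map P \<theta> f \<Phi> \<and>
       (\<forall>\<Psi> :: 'w \<Rightarrow> 'x. invariant_map P \<theta> f \<Psi> \<longrightarrow> (AE \<omega> in P. \<Psi> \<omega> = \<Phi> \<omega>)) \<and>
       \<Phi> \<in> borel_measurable (past P \<theta> f) \<and>
       (AE \<omega> in P. \<forall>x.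
          (\<lambda>n. (1 / real n) *
             (\<Sum>i<n. dist (random_product \<theta> f i \<omega> x) (\<Phi> ((\<theta> ^^ i) \<omega>)))) \<longlonglongrightarrow> 0))"
proof -
  interpret random_map_product P \<theta> f
    using assms by unfold_locales
  obtain \<mu> where \<mu>: "\<mu> \<in> invariant_measures P \<theta> f" using assms(4) by blast
  then have "invariant_measures P \<theta> f = {\<mu>}" using invariant_measure_unique by blast
  moreover obtain \<Phi> where "invariant_map P \<theta> f \<Phi>" "\<Phi> \<in> borel_measurable (past P \<theta> f)"
    using invariant_measure_is_graph[OF \<mu>] .
  ultimately show ?thesis
    using invariant_map_unique invariant_map_attracts by (auto simp: is_singleton_def)
qed

end
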